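(* For all $\boldsymbol{v} \in \mathbb{N}_0^d$ and $t \in \mathbb{R}$, $$2^{|\boldsymbol{v}|}\, \mathcal{B}^{(t)}_{\boldsymbol{v}}\!\left(\tfrac{\boldsymbol{x}}{2}\right) = E\big[\mathcal{E}^{(t)}_{\boldsymbol{v}}(\boldsymbol{x} + t \bullet \boldsymbol{\iota})\big],$$ where $\boldsymbol{\iota}$ is the multivariate Bernoulli umbra.
   Context: Setting (classical umbral calculus): there is an alphabet of umbrae and a linear evaluation functional $E$ with $E[1]=1$ and $E[\alpha^i\beta^j\cdots]=E[\alpha^i]E[\beta^j]\cdots$ for distinct umbrae; $E$ is extended to polynomials in indeterminates $\boldsymbol{x}=(x_1,\ldots,x_d)$ via $E[\boldsymbol{x}^{\boldsymbol{v}}\boldsymbol{\mu}^{\boldsymbol{w}}]=\boldsymbol{x}^{\boldsymbol{v}}E[\boldsymbol{\mu}^{\boldsymbol{w}}]$. Multi-index notation: $\boldsymbol{x}^{\boldsymbol{v}}=x_1^{v_1}\cdots x_d^{v_d}$, $|\boldsymbol{v}|=v_1+\cdots+v_d$. The generating function of a $d$-tuple of umbrae $\boldsymbol{\mu}$ is $f(\boldsymbol{\mu},\boldsymbol{z})=E[e^{\mu_1 z_1+\cdots+\mu_d z_d}]$. The multivariate Bernoulli umbra is $\boldsymbol{\iota}=(\iota,\ldots,\iota)$, where $\iota$ is the Bernoulli umbra with $f(\iota,z)=z/(e^z-1)$; the multivariate Euler umbra is $\boldsymbol{\eta}=(\eta,\ldots,\eta)$, where $\eta$ is the Euler umbra with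 $f(\eta,z)=2e^z/(e^{2z}+1)$; $\boldsymbol{u}=(u,\ldots,u)$ with $u$ the unity umbra (all moments equal to 1). For $t\in\mathbb{R}$, the dot-product $t\bullet\boldsymbol{\mu}$ is the auxiliary umbra with generating function $f(t\bullet\boldsymbol{\mu},\boldsymbol{z})=[f(\boldsymbol{\mu},\boldsymbol{z})]^t$ (the umbral counterpart of a multivariate Lévy process). The multivariate Bernoulli polynomials are $\mathcal{B}^{(t)}_{\boldsymbol{v}}(\boldsymbol{x})=E[(\boldsymbol{x}+t\bullet\boldsymbol{\iota})^{\boldsymbol{v}}]$ and the multivariate Euler polynomials are $\mathcal{E}^{(t)}_{\boldsymbol{v}}(\boldsymbol{x})=E\big[(\boldsymbol{x}+\tfrac12[t\bullet(\boldsymbol{\eta}-\boldsymbol{u})])^{\boldsymbol{v}}\big]$. *)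

theory Defs
  imports
    Complex_Main
    "HOL-Library.Poly_Mapping"
    "HOL-Computational_Algebra.Formal_Power_Series"
begin

section \<open>Multivariate polynomials\<close>

text \<open>
  Finitely supported functions from monomials to coefficients; the ring structure (convolution)
  is the one of \<^theory>\<open>HOL-Library.Poly_Mapping\<close>.
\<close>

type_synonym ('i, 'c) mpol = "('i \<Rightarrow>\<^sub>0 nat) \<Rightarrow>\<^sub>0 'c"

definition Const :: "'c::zero \<Rightarrow> ('i, 'c) mpol" where
  "Const c = Poly_Mapping.single 0 c"

definition Var :: "'i \<Rightarrow> ('i, 'c::zero_neq_one) mpol" where
  "Var i = Poly_Mapping.single (Poly_Mapping.single i 1) 1"

definition map_coeffs :: "('c::zero \<Rightarrow> 'e::zero) \<Rightarrow> ('i, 'c) mpol \<Rightarrow> ('i, 'e) mpol" where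
  "map_coeffs h p = Poly_Mapping.map h p"

text \<open>Substitution of \<open>\<sigma> i\<close> for the variable \<open>i\<close>, with coefficients sent to the target by \<open>h\<close>.\<close>

definition subst :: "('c::zero \<Rightarrow> 'r::comm_ring_1) \<Rightarrow> ('i \<Rightarrow> 'r) \<Rightarrow> ('i, 'c) mpol \<Rightarrow> 'r" where
  "subst h \<sigma> p =
     (\<Sum>m\<in>Poly_Mapping.keys p. h (Poly_Mapping.lookup p m)
        * (\<Prod>i\<in>Poly_Mapping.keys m. \<sigma> i ^ Poly_Mapping.lookup m i))"


section \<open>Multivariate formal power series\<close>

text \<open>
  A formal power series in the variables indexed by the finite type \<open>'d\<close> is given by its
  coefficients.
\<close>

type_synonym 'd mps = "('d \<Rightarrow> nat) \<Rightarrow> real"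

definition mps_mult :: "'d::finite mps \<Rightarrow> 'd mps \<Rightarrow> 'd mps" where
  "mps_mult f g v = (\<Sum>w\<in>{w. w \<le> v}. f w * g (\<lambda>i. v i - w i))"

primrec mps_power :: "'d::finite mps \<Rightarrow> nat \<Rightarrow> 'd mps" where
  "mps_power f 0 = (\<lambda>v. if v = (\<lambda>_. 0) then 1 else 0)"
| "mps_power f (Suc k) = mps_mult f (mps_power f k)"

text \<open>
  Real powers of a series with constant coefficient 1, by the binomial series
  \<open>f^t = (\<Sum>k. (t gchoose k) (f - 1)^k)\<close>. Since \<open>f - 1\<close> has constant coefficient 0, only
  \<open>k \<le> |v|\<close> contribute to the coefficient of \<open>z^v\<close>.
\<close>

definition mps_rpow :: "'d::finite mps \<Rightarrow> real \<Rightarrow> 'd mps" where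
  "mps_rpow f t v =
     (\<Sum>k\<le>(\<Sum>i\<in>UNIV. v i).
        (t gchoose k) * mps_power (\<lambda>w. f w - (if w = (\<lambda>_. 0) then 1 else 0)) k v)"


section \<open>Umbral calculus\<close>

text \<open>
  The alphabet is the type \<open>'u\<close>; umbral polynomials are real polynomials in its letters.
\<close>

type_synonym 'u umbral = "('u, real) mpol"

locale umbral_calculus =
  fixes E :: "'u umbral \<Rightarrow> real"
  assumes E_add: "E (p + q) = E p + E q"
    and E_scale: "E (Const c * p) = c * E p"
    and E_one: "E 1 = 1"
    and E_uncorrelated:
      "finite S \<Longrightarrow> E (\<Prod>\<alpha>\<in>S. Var \<alpha> ^ k \<alpha>) = (\<Prod>\<alpha>\<in>S. E (Var \<alpha> ^ k \<alpha>))"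

text \<open>
  The extension of the evaluation to \<open>\<real>[x][A]\<close>, with values in \<open>\<real>[x]\<close>: umbral monomials are
  evaluated, the coefficients in \<open>\<real>[x]\<close> are left alone.
\<close>

definition eval_x ::
  "('u umbral \<Rightarrow> real) \<Rightarrow> ('u, ('d, real) mpol) mpol \<Rightarrow> ('d, real) mpol" where
  "eval_x E p =
     (\<Sum>m\<in>Poly_Mapping.keys p.
        Poly_Mapping.lookup p m * Const (E (Poly_Mapping.single m 1)))"

text \<open>\<open>f(\<mu>, z) = E[exp (\<mu>\<^sub>1 z\<^sub>1 + \<dots> + \<mu>\<^sub>d z\<^sub>d)]\<close>: the coefficient of \<open>z^v\<close> is \<open>E[\<mu>^v] / v!\<close>.\<close>

definition gf1 :: "('u umbral \<Rightarrow> real) \<Rightarrow> 'u umbral \<Rightarrow> real fps" where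
  "gf1 E \<mu> = Abs_fps (\<lambda>n. E (\<mu> ^ n) / fact n)"

definition gf :: "('u umbral \<Rightarrow> real) \<Rightarrow> ('d::finite \<Rightarrow> 'u umbral) \<Rightarrow> 'd mps" where
  "gf E \<mu> v = E (\<Prod>i\<in>UNIV. \<mu> i ^ v i) / (\<Prod>i\<in>UNIV. fact (v i))"

definition bernoulli_umbra :: "('u umbral \<Rightarrow> real) \<Rightarrow> 'u \<Rightarrow> bool" where
  "bernoulli_umbra E \<iota> \<longleftrightarrow> gf1 E (Var \<iota>) = fps_X / (fps_exp 1 - 1)"

definition euler_umbra :: "('u umbral \<Rightarrow> real) \<Rightarrow> 'u \<Rightarrow> bool" where
  "euler_umbra E \<eta> \<longleftrightarrow> gf1 E (Var \<eta>) = 2 * fps_exp 1 / (fps_exp 2 + 1)"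

definition unity_umbra :: "('u umbral \<Rightarrow> real) \<Rightarrow> 'u \<Rightarrow> bool" where
  "unity_umbra E u \<longleftrightarrow> (\<forall>n. E (Var u ^ n) = 1)"

text \<open>
  The auxiliary umbra \<open>t \<bullet> \<mu>\<close> is characterised by its generating function only, so it is rendered
  as a relation: the tuple \<open>\<nu>\<close> represents \<open>t \<bullet> \<mu>\<close>.
\<close>

definition is_dot ::
  "('u umbral \<Rightarrow> real) \<Rightarrow> real \<Rightarrow> ('d::finite \<Rightarrow> 'u umbral) \<Rightarrow> ('d \<Rightarrow> 'u umbral) \<Rightarrow> bool" where
  "is_dot E t \<mu> \<nu> \<longleftrightarrow> gf E \<nu> = mps_rpow (gf E \<mu>) t"

text \<open>The element \<open>x\<^sub>i + \<mu>\<^sub>i\<close> of \<open>\<real>[x][A]\<close>.\<close>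

definition x_plus :: "('d \<Rightarrow> 'u umbral) \<Rightarrow> 'd \<Rightarrow> ('u, ('d, real) mpol) mpol" where
  "x_plus \<mu> i = Const (Var i) + map_coeffs Const (\<mu> i)"

text \<open>
  The multivariate Bernoulli polynomial \<open>E[(x + t \<bullet> \<iota>)^v]\<close> and Euler polynomial
  \<open>E[(x + (1/2) [t \<bullet> (\<eta> - u)])^v]\<close>, where the parameter \<open>t\<iota>\<close> represents \<open>t \<bullet> (\<iota>,\<dots>,\<iota>)\<close> and
  \<open>t\<eta>u\<close> represents \<open>t \<bullet> (\<eta> - u,\<dots>,\<eta> - u)\<close>.
\<close>

definition bernoulli_mpoly ::
  "('u umbral \<Rightarrow> real) \<Rightarrow> ('d::finite \<Rightarrow> 'u umbral) \<Rightarrow> ('d \<Rightarrow> nat) \<Rightarrow> ('d, real) mpol" where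
  "bernoulli_mpoly E t\<iota> v = eval_x E (\<Prod>i\<in>UNIV. x_plus t\<iota> i ^ v i)"

definition euler_mpoly ::
  "('u umbral \<Rightarrow> real) \<Rightarrow> ('d::finite \<Rightarrow> 'u umbral) \<Rightarrow> ('d \<Rightarrow> nat) \<Rightarrow> ('d, real) mpol" where
  "euler_mpoly E t\<eta>u v = eval_x E (\<Prod>i\<in>UNIV. x_plus (\<lambda>j. Const (1/2) * t\<eta>u j) i ^ v i)"

end

theory Submission
  imports Defs "HOL-Library.FuncSet"
begin

text \<open>
  Comparing coefficients of \<open>x^(v-s)\<close> on both sides, with \<open>e\<close> the moments of \<open>(1/2) (t \<bullet> (\<eta> - u))\<close>
  and \<open>b\<close> those of \<open>t \<bullet> \<iota>\<close>, leaves \<open>2^|s| b\<^sub>s = (\<Sum>a\<le>s. (s choose a) e\<^sub>a b\<^bsub>s-a\<^esub>)\<close>. Since the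
  tuples \<open>\<iota>\<close> and \<open>\<eta> - u\<close> are constant, their generating functions are univariate series evaluated
  at \<open>z\<^sub>1 + \<dots> + z\<^sub>d\<close>, a substitution that respects products and real powers. The identity thus
  becomes \<open>B(2z)^t = H(z/2)^t B(z)^t\<close> with \<open>B(z) = z/(e^z - 1)\<close> and \<open>H(z) = 2/(e^(2z) + 1)\<close>, and this
  follows from \<open>e^(2z) - 1 = (e^z - 1) (e^z + 1)\<close> and the multiplicativity of \<open>F \<mapsto> F^t\<close>.
\<close>

unbundle fps_syntax

section \<open>Real powers of power series\<close>

text \<open>The univariate analogue of \<open>mps_rpow\<close>: the binomial series of exponent
  \<open>t\<close> evaluated at \<open>F - 1\<close>. It is the power \<open>F^t\<close> when
  \<open>F\<close> has constant coefficient 1.\<close>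

definition fps_rpow :: "real fps \<Rightarrow> real \<Rightarrow> real fps" where
  "fps_rpow F t = fps_binomial t oo (F - 1)"

lemma fps_rpow_nth_0: "fps_rpow F t $ 0 = 1"
  by (simp add: fps_rpow_def)

text \<open>The binomial series \<open>y\<close> satisfies \<open>(1 + X) y' = t y\<close>;
  composing with \<open>F - 1\<close> and applying the chain rule gives the equation for
  \<open>F^t\<close>.\<close>

lemma fps_rpow_deriv:
  assumes "F $ 0 = 1"
  shows "F * fps_deriv (fps_rpow F t) = fps_const t * fps_rpow F t * fps_deriv F"
proof -
  have G0: "(F - 1) $ 0 = 0" using assms by simp
  \<comment> \<open>The derivative of the binomial series comes as a quotient by
    \<open>1 + fps_X\<close>; the division is exact because this series is a unit.\<close>
  have "(1 + fps_X) $ 0 \<noteq> (0::real)" by simp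
  then have "(1 + fps_X) * fps_deriv (fps_binomial t) = fps_const t * fps_binomial t"
    by (subst fps_binomial_deriv) (metis dvd_mult_div_cancel fps_is_unit_iff unit_imp_dvd)
  then have "((1 + fps_X) * fps_deriv (fps_binomial t)) oo (F - 1)
      = (fps_const t * fps_binomial t) oo (F - 1)"
    by simp
  then have "F * (fps_deriv (fps_binomial t) oo (F - 1)) = fps_const t * fps_rpow F t"
    using G0 by (simp add: fps_compose_mult_distrib fps_compose_add_distrib fps_rpow_def)
  then show ?thesis
    using fps_compose_deriv[OF G0, of "fps_binomial t"]
    by (simp add: fps_rpow_def mult.assoc[symmetric])
qed

text \<open>Both series have logarithmic derivative \<open>c / K\<close>.\<close>

lemma fps_log_deriv_unique:
  fixes H K L :: "real fps"
  assumes "K \<noteq> 0" and "H $ 0 = 1" and "L $ 0 = 1"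
    and H: "K * fps_deriv H = c * H" and L: "K * fps_deriv L = c * L"
  shows "H = L"
proof -
  have "K * (fps_deriv H * L - H * fps_deriv L) = (K * fps_deriv H) * L - H * (K * fps_deriv L)"
    by (simp add: algebra_simps)
  also have "\<dots> = 0" by (simp add: H L algebra_simps)
  finally have eq: "fps_deriv H * L = H * fps_deriv L"
    using \<open>K \<noteq> 0\<close> by simp
  have inv: "L * inverse L = 1"
    using \<open>L $ 0 = 1\<close> by (simp add: inverse_mult_eq_1')
  \<comment> \<open>The quotient \<open>H / L\<close> has derivative 0, so it is constant, and its
    constant coefficient is 1.\<close>
  have "fps_deriv (H * inverse L)
      = fps_deriv H * inverse L - H * fps_deriv L * (inverse L)\<^sup>2"
    using \<open>L $ 0 = 1\<close> by (simp add: fps_inverse_deriv algebra_simps)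
  also have "\<dots> = fps_deriv H * inverse L * (1 - L * inverse L)"
    unfolding eq[symmetric] by (simp add: power2_eq_square algebra_simps)
  finally have "fps_deriv (H * inverse L) = 0" by (simp add: inv)
  then have "H * inverse L = 1"
    unfolding fps_deriv_eq_0_iff using assms(2,3) by simp
  then have "H * (L * inverse L) = L" by (simp add: algebra_simps)
  then show ?thesis by (simp add: inv)
qed

text \<open>With \<open>K = F * G\<close>, both sides solve \<open>K y' = t K' y\<close> and have
  constant coefficient 1.\<close>

lemma fps_rpow_mult:
  assumes F: "F $ 0 = 1" and G: "G $ 0 = 1"
  shows "fps_rpow (F * G) t = fps_rpow F t * fps_rpow G t"
proof (rule fps_log_deriv_unique)
  show "F * G \<noteq> 0" using F G by auto
  show "fps_rpow (F * G) t $ 0 = 1" "(fps_rpow F t * fps_rpow G t) $ 0 = 1"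
    by (simp_all add: fps_rpow_nth_0)
  show "F * G * fps_deriv (fps_rpow (F * G) t)
      = fps_const t * fps_deriv (F * G) * fps_rpow (F * G) t"
    using fps_rpow_deriv[of "F * G" t] F G by (simp only: fps_mult_nth_0 mult_1 mult_ac)
  have "F * G * fps_deriv (fps_rpow F t * fps_rpow G t)
      = F * fps_rpow F t * (G * fps_deriv (fps_rpow G t))
        + G * fps_rpow G t * (F * fps_deriv (fps_rpow F t))"
    by (simp add: algebra_simps)
  then show "F * G * fps_deriv (fps_rpow F t * fps_rpow G t)
      = fps_const t * fps_deriv (F * G) * (fps_rpow F t * fps_rpow G t)"
    unfolding fps_rpow_deriv[OF F] fps_rpow_deriv[OF G] by (simp add: algebra_simps)
qed

text \<open>Associativity of composition. It allows an identity between rescaled generating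
  functions to be raised to the power \<open>t\<close>.\<close>

lemma fps_rpow_compose_linear:
  assumes "F $ 0 = 1"
  shows "fps_rpow F t oo (fps_const c * fps_X) = fps_rpow (F oo (fps_const c * fps_X)) t"
  using assms unfolding fps_rpow_def
  by (subst fps_compose_assoc[symmetric]) (simp_all add: fps_compose_sub_distrib)

section \<open>Diagonal multivariate series\<close>

text \<open>The series \<open>F(z\<^sub>1 + \<dots> + z\<^sub>d)\<close>.\<close>

definition sum_subst :: "real fps \<Rightarrow> 'd::finite mps" where
  "sum_subst F v = F $ (\<Sum>i\<in>UNIV. v i) * fact (\<Sum>i\<in>UNIV. v i) / (\<Prod>i\<in>UNIV. fact (v i))"

text \<open>In this form a product of sums over \<open>{..v i}\<close> expands, by
  \<open>prod_sum_PiE\<close>, into one sum over multi-indices.\<close>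

lemma atMost_fun_PiE: "{w. w \<le> v} = PiE UNIV (\<lambda>i. {..v i :: nat})"
  by (auto simp: le_fun_def)

lemma finite_atMost_fun: "finite {w. w \<le> (v :: 'd::finite \<Rightarrow> nat)}"
  unfolding atMost_fun_PiE by (intro finite_PiE) auto

text \<open>Both sides are the coefficient of \<open>X^k\<close> in \<open>(1 + X)^|v|\<close>, the
  left one after multiplying out the factors \<open>(1 + X)^(v i)\<close>.\<close>

lemma vandermonde_prod:
  fixes v :: "'d::finite \<Rightarrow> nat"
  shows "(\<Sum>w | w \<le> v \<and> (\<Sum>i\<in>UNIV. w i) = k. \<Prod>i\<in>UNIV. real (v i choose w i))
      = real ((\<Sum>i\<in>UNIV. v i) choose k)"
proof -
  have const_prod: "(\<Prod>i\<in>A. fps_const (c i)) = fps_const (\<Prod>i\<in>A. c i)"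
    for c :: "'d \<Rightarrow> real" and A
    by (induction A rule: infinite_finite_induct) (simp_all flip: fps_const_mult)
  have pow: "(1 + fps_X :: real fps) ^ n = (\<Sum>j\<le>n. fps_const (real (n choose j)) * fps_X ^ j)" for n
    by (subst add.commute, subst binomial_ring)
       (simp add: fps_of_nat[symmetric])
  have "(1 + fps_X :: real fps) ^ (\<Sum>i\<in>UNIV. v i) = (\<Prod>i\<in>UNIV. (1 + fps_X) ^ v i)"
    by (simp add: power_sum)
  also have "\<dots> = (\<Sum>w | w \<le> v. \<Prod>i\<in>UNIV. fps_const (real (v i choose w i)) * fps_X ^ w i)"
    unfolding pow atMost_fun_PiE by (rule prod_sum_PiE) auto
  also have "\<dots> = (\<Sum>w | w \<le> v. fps_const (\<Prod>i\<in>UNIV. real (v i choose w i))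
      * fps_X ^ (\<Sum>i\<in>UNIV. w i))"
    by (simp add: prod.distrib power_sum const_prod)
  finally have "(1 + fps_X :: real fps) ^ (\<Sum>i\<in>UNIV. v i) $ k
      = (\<Sum>w | w \<le> v. (\<Prod>i\<in>UNIV. real (v i choose w i)) * (if (\<Sum>i\<in>UNIV. w i) = k then 1 else 0))"
    by (simp add: fps_sum_nth eq_commute)
  also have "\<dots> = (\<Sum>w | w \<le> v \<and> (\<Sum>i\<in>UNIV. w i) = k. \<Prod>i\<in>UNIV. real (v i choose w i))"
    using finite_atMost_fun[of v]
    by (intro sum.mono_neutral_cong_right) auto
  finally show ?thesis
    using fps_binomial_of_nat[of "\<Sum>i\<in>UNIV. v i", where 'a = real]
    by (simp add: binomial_gbinomial fps_eq_iff)
qed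

text \<open>Group the multi-indices \<open>w\<close> by their total degree and apply
  \<open>vandermonde_prod\<close> to each group.\<close>

lemma sum_choose_total:
  fixes v :: "'d::finite \<Rightarrow> nat" and h :: "nat \<Rightarrow> real"
  shows "(\<Sum>w | w \<le> v. (\<Prod>i\<in>UNIV. real (v i choose w i)) * h (\<Sum>i\<in>UNIV. w i))
      = (\<Sum>k\<le>(\<Sum>i\<in>UNIV. v i). real ((\<Sum>i\<in>UNIV. v i) choose k) * h k)"
proof -
  have "(\<Sum>w | w \<le> v. (\<Prod>i\<in>UNIV. real (v i choose w i)) * h (\<Sum>i\<in>UNIV. w i))
      = (\<Sum>k\<le>(\<Sum>i\<in>UNIV. v i). \<Sum>w\<in>{w. w \<in> {w. w \<le> v} \<and> (\<Sum>i\<in>UNIV. w i) = k}.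
          (\<Prod>i\<in>UNIV. real (v i choose w i)) * h (\<Sum>i\<in>UNIV. w i))"
    by (rule sum.group[symmetric]) (auto simp: finite_atMost_fun le_funD intro!: sum_mono)
  also have "\<dots> = (\<Sum>k\<le>(\<Sum>i\<in>UNIV. v i). real ((\<Sum>i\<in>UNIV. v i) choose k) * h k)"
    by (intro sum.cong refl) (simp add: vandermonde_prod[symmetric] sum_distrib_right)
  finally show ?thesis .
qed

lemma prod_fact_split:
  fixes v w :: "'d::finite \<Rightarrow> nat"
  assumes "w \<le> v"
  shows "(\<Prod>i\<in>UNIV. fact (v i)) = (\<Prod>i\<in>UNIV. real (v i choose w i))
      * ((\<Prod>i\<in>UNIV. fact (w i)) * (\<Prod>i\<in>UNIV. fact (v i - w i)))"
proof -
  have "fact (v i) = real (v i choose w i) * (fact (w i) * fact (v i - w i))" for i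
    using binomial_fact_lemma[of "w i" "v i"] assms
    by (metis (no_types, lifting) le_fun_def mult.commute of_nat_fact of_nat_mult)
  then show ?thesis by (simp add: prod.distrib)
qed

lemma sum_fun_diff:
  fixes v w :: "'d::finite \<Rightarrow> nat"
  assumes "w \<le> v"
  shows "(\<Sum>i\<in>UNIV. v i - w i) = (\<Sum>i\<in>UNIV. v i) - (\<Sum>i\<in>UNIV. w i)"
  using assms by (intro sum_subtractf_nat) (auto simp: le_fun_def)

text \<open>Apart from the binomials the summand depends only on \<open>|w|\<close>, so the sum
  collapses to the univariate binomial convolution, which is the product rule for exponential
  generating functions.\<close>

lemma sum_choose_convolution:
  fixes v :: "'d::finite \<Rightarrow> nat"
  shows "(\<Sum>w | w \<le> v. (\<Prod>i\<in>UNIV. real (v i choose w i))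
        * ((F $ (\<Sum>i\<in>UNIV. w i) * fact (\<Sum>i\<in>UNIV. w i))
         * (G $ (\<Sum>i\<in>UNIV. v i - w i) * fact (\<Sum>i\<in>UNIV. v i - w i))))
      = (F * G) $ (\<Sum>i\<in>UNIV. v i) * fact (\<Sum>i\<in>UNIV. v i)"
proof -
  define n where "n = (\<Sum>i\<in>UNIV. v i)"
  have "(\<Sum>w | w \<le> v. (\<Prod>i\<in>UNIV. real (v i choose w i))
        * ((F $ (\<Sum>i\<in>UNIV. w i) * fact (\<Sum>i\<in>UNIV. w i))
         * (G $ (\<Sum>i\<in>UNIV. v i - w i) * fact (\<Sum>i\<in>UNIV. v i - w i))))
      = (\<Sum>k\<le>n. real (n choose k) * ((F $ k * fact k) * (G $ (n - k) * fact (n - k))))"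
    unfolding n_def sum_choose_total[symmetric] by (intro sum.cong refl) (simp add: sum_fun_diff)
  also have "\<dots> = (\<Sum>k\<le>n. F $ k * G $ (n - k) * fact n)"
    by (intro sum.cong refl) (simp add: binomial_fact)
  finally show ?thesis by (simp add: n_def fps_mult_nth sum_distrib_right atLeast0AtMost)
qed

text \<open>Multiplied by the factorials of \<open>v\<close>, the Cauchy product over multi-indices
  is the sum in \<open>sum_choose_convolution\<close>.\<close>

lemma sum_subst_mult: "mps_mult (sum_subst F) (sum_subst G) = sum_subst (F * G)"
proof
  fix v :: "'a \<Rightarrow> nat"
  show "mps_mult (sum_subst F) (sum_subst G) v = sum_subst (F * G) v"
    unfolding mps_mult_def sum_subst_def sum_choose_convolution[symmetric] sum_divide_distrib
  proof (intro sum.cong refl)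
    fix w assume "w \<in> {w. w \<le> v}"
    then have "w \<le> v" by simp
    moreover have "(\<Prod>i\<in>UNIV. real (v i choose w i)) \<noteq> 0"
      using \<open>w \<le> v\<close> by (auto simp: le_fun_def not_less[symmetric])
    ultimately show "F $ sum w UNIV * fact (sum w UNIV) / (\<Prod>i\<in>UNIV. fact (w i)) *
         (G $ (\<Sum>i\<in>UNIV. v i - w i) * fact (\<Sum>i\<in>UNIV. v i - w i) / (\<Prod>i\<in>UNIV. fact (v i - w i))) =
         (\<Prod>i\<in>UNIV. real (v i choose w i)) *
         (F $ sum w UNIV * fact (sum w UNIV) *
          (G $ (\<Sum>i\<in>UNIV. v i - w i) * fact (\<Sum>i\<in>UNIV. v i - w i))) /
         (\<Prod>i\<in>UNIV. fact (v i))"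
      by (simp add: prod_fact_split[OF \<open>w \<le> v\<close>])
  qed
qed

lemma sum_subst_1: "sum_subst 1 v = (if v = (\<lambda>_. 0) then 1 else 0)"
  by (auto simp: sum_subst_def fun_eq_iff)

lemma sum_subst_power: "mps_power (sum_subst F) k = sum_subst (F ^ k)"
  by (induction k) (auto simp: sum_subst_mult sum_subst_1)

lemma sum_subst_diff: "sum_subst (F - G) v = sum_subst F v - sum_subst G v"
  by (simp add: sum_subst_def algebra_simps diff_divide_distrib)

text \<open>Both \<open>mps_rpow\<close> and the composition in \<open>fps_rpow\<close> stop the
  binomial series at the total degree \<open>|v|\<close>, so the two sides agree term by
  term.\<close>

lemma sum_subst_rpow: "mps_rpow (sum_subst F) t = sum_subst (fps_rpow F t)"
proof
  fix v :: "'a \<Rightarrow> nat"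
  have "(\<lambda>w. sum_subst F w - (if w = (\<lambda>_. 0) then 1 else 0)) = (sum_subst (F - 1) :: 'a mps)"
    by (simp add: sum_subst_diff sum_subst_1 fun_eq_iff)
  then show "mps_rpow (sum_subst F) t v = sum_subst (fps_rpow F t) v"
    by (simp add: mps_rpow_def sum_subst_power)
       (simp add: sum_subst_def fps_rpow_def fps_compose_nth sum_distrib_right
          sum_divide_distrib atLeast0AtMost mult.assoc)
qed

text \<open>For equal entries the moment of index \<open>v\<close> is the moment of order
  \<open>|v|\<close>; the factor \<open>fact |v|\<close> in \<open>sum_subst\<close> undoes the
  normalisation in \<open>gf1\<close>.\<close>

lemma gf_diagonal: "gf E (\<lambda>_. \<mu>) = sum_subst (gf1 E \<mu>)"
  by (simp add: gf_def sum_subst_def gf1_def power_sum fun_eq_iff)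

text \<open>Translates the relation \<open>is_dot\<close> into moments, which for a constant tuple
  depend only on \<open>|v|\<close>.\<close>

lemma moment_dot_diagonal:
  assumes "is_dot E t (\<lambda>_. \<mu>) \<nu>"
  shows "E (\<Prod>i\<in>UNIV. \<nu> i ^ v i) = fps_rpow (gf1 E \<mu>) t $ (\<Sum>i\<in>UNIV. v i) * fact (\<Sum>i\<in>UNIV. v i)"
proof -
  have "gf E \<nu> v = sum_subst (fps_rpow (gf1 E \<mu>) t) v"
    using assms by (simp add: is_dot_def gf_diagonal sum_subst_rpow)
  then show ?thesis
    by (simp add: gf_def sum_subst_def divide_simps split: if_splits)
qed

section \<open>Double sums over multi-indices\<close>

text \<open>Substitute \<open>s = a + r\<close>; the inverse \<open>r = s - a\<close> involves no
  truncation because \<open>a \<le> s\<close>.\<close>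

lemma sum_fun_le_swap:
  fixes v :: "'d::finite \<Rightarrow> nat" and g :: "('d \<Rightarrow> nat) \<Rightarrow> ('d \<Rightarrow> nat) \<Rightarrow> 'r::comm_monoid_add"
  shows "(\<Sum>s | s \<le> v. \<Sum>a | a \<le> s. g s a)
    = (\<Sum>a | a \<le> v. \<Sum>r | r \<le> (\<lambda>i. v i - a i). g (\<lambda>i. a i + r i) a)"
proof -
  have "(\<Sum>(s, a)\<in>(SIGMA s:{s. s \<le> v}. {a. a \<le> s}). g s a)
      = (\<Sum>(a, r)\<in>(SIGMA a:{a. a \<le> v}. {r. r \<le> (\<lambda>i. v i - a i)}). g (\<lambda>i. a i + r i) a)"
    by (rule sum.reindex_bij_witness
          [where i = "\<lambda>(a, r). (\<lambda>i. a i + r i, a)" and j = "\<lambda>(s, a). (a, \<lambda>i. s i - a i)"])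
       (auto simp: le_fun_def fun_eq_iff le_diff_conv2 diff_le_mono add.commute
         intro: order_trans)
  then show ?thesis
    by (simp add: sum.Sigma finite_atMost_fun)
qed

lemma prod_choose_mult:
  fixes v :: "'d::finite \<Rightarrow> nat"
  assumes "a \<le> s" and "s \<le> v"
  shows "(\<Prod>i\<in>UNIV. real (v i choose s i)) * (\<Prod>i\<in>UNIV. real (s i choose a i))
    = (\<Prod>i\<in>UNIV. real (v i choose a i)) * (\<Prod>i\<in>UNIV. real ((v i - a i) choose (s i - a i)))"
  using assms unfolding prod.distrib[symmetric] of_nat_mult[symmetric]
  by (intro prod.cong refl arg_cong[where f = real] choose_mult) (auto simp: le_fun_def)

section \<open>Polynomials and the evaluation functional\<close>

lemma poly_mapping_induct_add [case_names zero single add]: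
  assumes "P 0" and "\<And>m c. P (Poly_Mapping.single m c)"
    and "\<And>p q. P p \<Longrightarrow> P q \<Longrightarrow> P (p + q)"
  shows "P (p :: 'k \<Rightarrow>\<^sub>0 'c::comm_monoid_add)"
proof (induction p rule: update_induct)
  case const
  then show ?case by (rule assms)
next
  case (update f a b)
  have "Poly_Mapping.update a b f = f + Poly_Mapping.single a b"
    using update(1)
    by (intro poly_mapping_eqI) (auto simp: lookup_update lookup_add lookup_single in_keys_iff when_def)
  then show ?case using assms(2,3) update(3) by simp
qed

lemma Const_0 [simp]: "Const 0 = 0"
  by (simp add: Const_def)

lemma Const_1 [simp]: "Const 1 = 1"
  by (simp add: Const_def)

lemma Const_add: "Const (a + b) = Const a + Const b"
  by (simp add: Const_def single_add)

lemma Const_mult: "Const (a * b) = Const a * Const (b :: 'c::comm_semiring_1)"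
  by (simp add: Const_def mult_single)

lemma Const_power: "Const (a ^ n) = Const (a :: 'c::comm_semiring_1) ^ n"
  by (induction n) (simp_all add: Const_mult)

lemma Const_prod: "Const (\<Prod>i\<in>A. f i) = (\<Prod>i\<in>A. Const (f i :: 'c::comm_semiring_1))"
  by (induction A rule: infinite_finite_induct) (simp_all add: Const_mult)

lemma Const_sum: "Const (\<Sum>i\<in>A. f i) = (\<Sum>i\<in>A. Const (f i))"
  by (induction A rule: infinite_finite_induct) (simp_all add: Const_add)

lemma Const_of_nat: "Const (of_nat n) = (of_nat n :: ('i, 'c::comm_semiring_1) mpol)"
  by (simp add: Const_def)

lemma Const_mult_single:
  "Const a * Poly_Mapping.single m b = Poly_Mapping.single m (a * b :: 'c::comm_semiring_1)"
  by (simp add: Const_def mult_single)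

lemma lookup_map_coeffs:
  "h 0 = 0 \<Longrightarrow> Poly_Mapping.lookup (map_coeffs h p) m = h (Poly_Mapping.lookup p m)"
  by (simp add: map_coeffs_def Poly_Mapping.map.rep_eq when_def)

lemma map_coeffs_0 [simp]: "map_coeffs h 0 = 0"
  by (intro poly_mapping_eqI) (simp add: map_coeffs_def Poly_Mapping.map.rep_eq)

lemma map_coeffs_add:
  assumes "h 0 = 0" and "\<And>a b. h (a + b) = h a + h b"
  shows "map_coeffs h (p + q) = map_coeffs h p + map_coeffs h q"
  using assms by (intro poly_mapping_eqI) (simp add: lookup_map_coeffs lookup_add)

lemma map_coeffs_single:
  assumes "h 0 = 0"
  shows "map_coeffs h (Poly_Mapping.single m c) = Poly_Mapping.single m (h c)"
  using assms by (simp add: map_coeffs_def)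

lemma map_coeffs_mult:
  fixes h :: "'c::comm_semiring_1 \<Rightarrow> 'e::comm_semiring_1"
  assumes "h 0 = 0" and "\<And>a b. h (a + b) = h a + h b" and "\<And>a b. h (a * b) = h a * h b"
  shows "map_coeffs h (p * q) = map_coeffs h p * map_coeffs h q"
proof (induction p rule: poly_mapping_induct_add)
  case zero
  show ?case by simp
next
  case (single m c)
  show ?case
  proof (induction q rule: poly_mapping_induct_add)
    case zero
    show ?case by simp
  next
    case (single n d)
    show ?case using assms by (simp add: mult_single map_coeffs_single)
  next
    case (add p q)
    then show ?case using assms(1,2) by (simp add: distrib_left map_coeffs_add)
  qed
next
  case (add p q)
  then show ?case using assms(1,2) by (simp add: distrib_right map_coeffs_add)
qed

lemma map_coeffs_1: "h 0 = 0 \<Longrightarrow> h 1 = 1 \<Longrightarrow> map_coeffs h 1 = 1"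
  by (simp add: map_coeffs_single flip: single_one)

lemma map_coeffs_Const_power:
  "map_coeffs Const (p ^ n) = map_coeffs Const (p :: ('i, 'c::comm_semiring_1) mpol) ^ n"
  by (induction n) (simp_all add: map_coeffs_1 map_coeffs_mult Const_add Const_mult)

lemma map_coeffs_Const_prod:
  "map_coeffs Const (\<Prod>i\<in>A. p i) = (\<Prod>i\<in>A. map_coeffs Const (p i :: ('i, 'c::comm_semiring_1) mpol))"
  by (induction A rule: infinite_finite_induct)
     (simp_all add: map_coeffs_1 map_coeffs_mult Const_add Const_mult)

section \<open>Substitution into polynomials\<close>

lemma subst_add:
  assumes "h 0 = 0" and "\<And>a b. h (a + b) = h a + h b"
  shows "subst h \<sigma> (p + q) = subst h \<sigma> p + subst h \<sigma> q"
proof -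
  \<comment> \<open>Cancellation may make the keys of \<open>p + q\<close> fewer than the union;
    over this common index set the extra terms vanish since \<open>h 0 = 0\<close>.\<close>
  have eq: "subst h \<sigma> r = (\<Sum>m\<in>Poly_Mapping.keys p \<union> Poly_Mapping.keys q.
      h (Poly_Mapping.lookup r m) * (\<Prod>i\<in>Poly_Mapping.keys m. \<sigma> i ^ Poly_Mapping.lookup m i))"
    if "Poly_Mapping.keys r \<subseteq> Poly_Mapping.keys p \<union> Poly_Mapping.keys q" for r
    unfolding subst_def using that
    by (intro sum.mono_neutral_left) (auto simp: in_keys_iff assms(1))
  show ?thesis
    by (simp add: eq keys_add lookup_add assms(2) distrib_right sum.distrib)
qed

lemma subst_single:
  "h 0 = 0 \<Longrightarrow> subst h \<sigma> (Poly_Mapping.single m c)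
     = h c * (\<Prod>i\<in>Poly_Mapping.keys m. \<sigma> i ^ Poly_Mapping.lookup m i)"
  by (simp add: subst_def)

lemma subst_sum:
  assumes "h 0 = 0" and "\<And>a b. h (a + b) = h a + h b"
  shows "subst h \<sigma> (\<Sum>j\<in>A. p j) = (\<Sum>j\<in>A. subst h \<sigma> (p j))"
  using assms
  by (induction A rule: infinite_finite_induct) (simp_all add: subst_add, simp_all add: subst_def)

lemma Var_power: "Var i ^ n = Poly_Mapping.single (Poly_Mapping.single i n) (1 :: 'c::comm_semiring_1)"
  by (induction n) (simp_all add: Var_def mult_single flip: single_add)

text \<open>Since \<open>'d\<close> is finite, every exponent function has finite support and
  \<open>Abs_poly_mapping a\<close> is a genuine monomial.\<close>

lemma prod_Var_power:
  "(\<Prod>i\<in>UNIV. Var i ^ a i) = Poly_Mapping.single (Abs_poly_mapping a) (1 :: 'c::comm_semiring_1)"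
  for a :: "'d::finite \<Rightarrow> nat"
proof -
  have "(\<Prod>i\<in>A. Var i ^ a i) = Poly_Mapping.single (\<Sum>i\<in>A. Poly_Mapping.single i (a i)) (1 :: 'c)" for A
    by (induction A rule: infinite_finite_induct) (simp_all add: Var_power mult_single)
  moreover have "(\<Sum>i\<in>UNIV. Poly_Mapping.single i (a i)) = Abs_poly_mapping a"
    by (intro poly_mapping_eqI) (simp add: lookup_sum lookup_single when_def)
  ultimately show ?thesis by simp
qed

text \<open>Together with \<open>subst_sum\<close> this computes substitutions into polynomials
  written as explicit sums of monomials, the form provided by
  \<open>eval_x_prod_x_plus\<close>.\<close>

lemma subst_monomial:
  fixes a :: "'d::finite \<Rightarrow> nat" and c :: "'c::comm_semiring_1"
  assumes "h 0 = 0"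
  shows "subst h \<sigma> (Const c * (\<Prod>i\<in>UNIV. Var i ^ a i)) = h c * (\<Prod>i\<in>UNIV. \<sigma> i ^ a i)"
proof -
  have "(\<Prod>i\<in>Poly_Mapping.keys (Abs_poly_mapping a). \<sigma> i ^ a i) = (\<Prod>i\<in>UNIV. \<sigma> i ^ a i)"
    by (intro prod.mono_neutral_left) (auto simp: in_keys_iff)
  then show ?thesis
    using assms by (simp add: prod_Var_power Const_mult_single subst_single)
qed

section \<open>Evaluation over the polynomials in \<open>x\<close>\<close>

lemma eval_x_add: "eval_x E (p + q) = eval_x E p + eval_x E q"
proof -
  have eq: "eval_x E r = (\<Sum>m\<in>Poly_Mapping.keys p \<union> Poly_Mapping.keys q.
      Poly_Mapping.lookup r m * Const (E (Poly_Mapping.single m 1)))"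
    if "Poly_Mapping.keys r \<subseteq> Poly_Mapping.keys p \<union> Poly_Mapping.keys q" for r
    unfolding eval_x_def using that
    by (intro sum.mono_neutral_left) (auto simp: in_keys_iff)
  show ?thesis
    by (simp add: eq keys_add lookup_add distrib_right sum.distrib)
qed

lemma eval_x_0: "eval_x E 0 = 0"
  by (simp add: eval_x_def)

lemma eval_x_sum: "eval_x E (\<Sum>j\<in>A. p j) = (\<Sum>j\<in>A. eval_x E (p j))"
  by (induction A rule: infinite_finite_induct) (simp_all add: eval_x_add eval_x_0)

lemma eval_x_single: "eval_x E (Poly_Mapping.single m c) = c * Const (E (Poly_Mapping.single m 1))"
  by (simp add: eval_x_def)

lemma eval_x_scale: "eval_x E (Const c * p) = c * eval_x E p"
  by (induction p rule: poly_mapping_induct_add)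
     (simp_all add: eval_x_0 Const_mult_single eval_x_single eval_x_add distrib_left mult.assoc)

context umbral_calculus
begin

lemma E_zero: "E 0 = 0"
  using E_scale[of 0 0] by simp

lemma E_sum: "E (\<Sum>j\<in>A. p j) = (\<Sum>j\<in>A. E (p j))"
  by (induction A rule: infinite_finite_induct) (simp_all add: E_zero E_add)

lemma eval_x_map_coeffs: "eval_x E (map_coeffs Const q) = Const (E q)"
proof (induction q rule: poly_mapping_induct_add)
  case zero
  show ?case by (simp add: eval_x_0 E_zero)
next
  case (single m c)
  have "E (Poly_Mapping.single m c) = c * E (Poly_Mapping.single m 1)"
    using E_scale[of c "Poly_Mapping.single m 1"] by (simp add: Const_mult_single)
  then show ?case by (simp add: map_coeffs_single eval_x_single Const_mult)
next
  case (add p q)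
  then show ?case by (simp add: map_coeffs_add Const_add eval_x_add E_add)
qed

text \<open>Expand each factor by the binomial theorem, multiply out, and pull the polynomials in
  \<open>x\<close> out of the evaluation.\<close>

lemma eval_x_prod_x_plus:
  fixes \<mu> :: "'d::finite \<Rightarrow> 'u umbral"
  shows "eval_x E (\<Prod>i\<in>UNIV. x_plus \<mu> i ^ v i)
    = (\<Sum>w | w \<le> v. Const ((\<Prod>i\<in>UNIV. real (v i choose w i)) * E (\<Prod>i\<in>UNIV. \<mu> i ^ w i))
        * (\<Prod>i\<in>UNIV. Var i ^ (v i - w i)))"
proof -
  define c where "c n k = (Const (Const (real (n choose k))) :: ('u, ('d, real) mpol) mpol)" for n k
  have "x_plus \<mu> i ^ v i = (\<Sum>k\<le>v i. c (v i) k * (map_coeffs Const (\<mu> i) ^ k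
      * Const (Var i ^ (v i - k))))" for i
    unfolding x_plus_def
    by (subst add.commute, subst binomial_ring)
       (simp add: c_def Const_of_nat Const_power mult.assoc)
  then have "(\<Prod>i\<in>UNIV. x_plus \<mu> i ^ v i)
      = (\<Sum>w | w \<le> v. \<Prod>i\<in>UNIV. c (v i) (w i) * (map_coeffs Const (\<mu> i) ^ w i
          * Const (Var i ^ (v i - w i))))"
    unfolding atMost_fun_PiE by (simp add: prod_sum_PiE)
  also have "\<dots> = (\<Sum>w | w \<le> v. Const (Const (\<Prod>i\<in>UNIV. real (v i choose w i))
      * (\<Prod>i\<in>UNIV. Var i ^ (v i - w i))) * map_coeffs Const (\<Prod>i\<in>UNIV. \<mu> i ^ w i))"
    by (simp add: c_def prod.distrib Const_prod Const_mult map_coeffs_Const_prod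
        map_coeffs_Const_power mult_ac)
  finally show ?thesis
    by (simp only: eval_x_sum eval_x_scale eval_x_map_coeffs) (simp add: Const_mult mult_ac)
qed

lemma E_scale_prod:
  "E (\<Prod>i\<in>UNIV. (Const c * \<mu> i) ^ w i) = c ^ (\<Sum>i\<in>UNIV. w i) * E (\<Prod>i\<in>(UNIV :: 'd::finite set). \<mu> i ^ w i)"
  by (simp add: power_mult_distrib prod.distrib power_sum Const_power Const_prod flip: E_scale)

section \<open>Generating functions of the Bernoulli and Euler umbrae\<close>

lemma gf1_nth_0: "gf1 E \<mu> $ 0 = 1"
  by (simp add: gf1_def E_one)

text \<open>As \<open>\<eta>\<close> and \<open>u\<close> are uncorrelated and all moments of
  \<open>u\<close> are 1, \<open>u\<close> behaves like the constant 1, and subtracting it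
  multiplies the generating function by \<open>exp(-z)\<close>.\<close>

lemma gf1_diff_unity:
  assumes "\<eta> \<noteq> u" and "unity_umbra E u"
  shows "gf1 E (Var \<eta> - Var u) = gf1 E (Var \<eta>) * fps_exp (-1)"
proof (rule fps_ext)
  fix n
  have E2: "E (Var \<eta> ^ k * Var u ^ m) = E (Var \<eta> ^ k)" for k m
    using E_uncorrelated[of "{\<eta>, u}" "\<lambda>\<alpha>. if \<alpha> = u then m else k"] assms
    by (simp add: unity_umbra_def)
  have "(Var \<eta> - Var u :: 'u umbral) ^ n = (Var \<eta> + Const (-1) * Var u) ^ n"
    by (simp add: Const_def single_uminus)
  also have "\<dots> = (\<Sum>k\<le>n. Const (real (n choose k) * (-1) ^ (n - k)) * (Var \<eta> ^ k * Var u ^ (n - k)))"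
    by (subst binomial_ring)
       (simp add: Const_of_nat Const_power Const_mult power_mult_distrib mult_ac)
  finally have "E ((Var \<eta> - Var u) ^ n)
      = (\<Sum>k\<le>n. real (n choose k) * (-1) ^ (n - k) * E (Var \<eta> ^ k))"
    by (simp add: E_sum E_scale E2)
  then show "gf1 E (Var \<eta> - Var u) $ n = (gf1 E (Var \<eta>) * fps_exp (-1)) $ n"
    unfolding fps_mult_nth
    by (simp add: gf1_def sum_divide_distrib atLeast0AtMost binomial_fact field_simps)
qed

lemma gf1_bernoulli:
  assumes "bernoulli_umbra E \<iota>"
  shows "gf1 E (Var \<iota>) * (fps_exp 1 - 1) = fps_X"
proof -
  \<comment> \<open>The divisor has constant coefficient 0 and is no unit, but its subdegree is at
    most 1, so it divides \<open>fps_X\<close> exactly.\<close>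
  have ne: "fps_exp 1 - 1 \<noteq> (0 :: real fps)"
    by (auto dest!: arg_cong[where f = "\<lambda>f. f $ 1"])
  then have "subdegree (fps_exp 1 - 1 :: real fps) \<le> 1"
    by (intro subdegree_leI) simp
  then have "(fps_exp 1 - 1 :: real fps) dvd fps_X"
    using ne by (subst fps_dvd_iff) auto
  then show ?thesis
    using assms by (simp add: bernoulli_umbra_def)
qed

lemma gf1_euler:
  assumes "euler_umbra E \<eta>"
  shows "gf1 E (Var \<eta>) * (fps_exp 2 + 1) = 2 * fps_exp 1"
proof -
  have "is_unit (fps_exp 2 + 1 :: real fps)" by (subst fps_is_unit_iff) simp
  then show ?thesis
    using assms by (simp add: euler_umbra_def unit_imp_dvd)
qed

text \<open>Supplies the distinctness needed to factor joint moments. Equality would force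
  \<open>exp(2z) = 1\<close>, which the coefficient of \<open>z\<close> refutes.\<close>

lemma euler_neq_unity:
  assumes "euler_umbra E \<eta>" and "unity_umbra E u"
  shows "\<eta> \<noteq> u"
proof
  assume "\<eta> = u"
  then have "gf1 E (Var \<eta>) = fps_exp 1"
    using assms(2) by (simp add: gf1_def unity_umbra_def fps_eq_iff)
  then have "fps_exp 1 * (fps_exp 2 + 1) = (2 * fps_exp 1 :: real fps)"
    using gf1_euler[OF assms(1)] by simp
  then have "fps_exp 1 * (fps_exp 2 - 1) = (0 :: real fps)"
    by (simp add: algebra_simps)
  then have "fps_exp 2 - 1 = (0 :: real fps)"
    by (simp del: right_minus_eq)
  then have "(fps_exp 2 - 1 :: real fps) $ 1 = 0" by simp
  then show False by simp
qed

lemma gf1_euler_diff_unity: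
  assumes "euler_umbra E \<eta>" and "unity_umbra E u"
  shows "gf1 E (Var \<eta> - Var u) * (fps_exp 2 + 1) = 2"
proof -
  have "gf1 E (Var \<eta> - Var u) * (fps_exp 2 + 1)
      = gf1 E (Var \<eta>) * (fps_exp 2 + 1) * fps_exp (-1)"
    using gf1_diff_unity[OF euler_neq_unity] assms by (simp add: mult_ac)
  also have "\<dots> = 2 * (fps_exp 1 * fps_exp (-1))"
    by (simp add: gf1_euler[OF assms(1)] mult_ac)
  also have "fps_exp 1 * fps_exp (-1) = (1 :: real fps)"
    by (simp flip: fps_exp_add_mult)
  finally show ?thesis by simp
qed

text \<open>With \<open>e = exp(z)\<close>, the cleared equations are
  \<open>B(2z) (e^2 - 1) = 2z\<close>, \<open>H(z/2) (e + 1) = 2\<close> and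
  \<open>B(z) (e - 1) = z\<close>; the product of the last two has the right-hand side of the
  first.\<close>

lemma gf1_bernoulli_duplication:
  assumes "bernoulli_umbra E \<iota>" and "euler_umbra E \<eta>" and "unity_umbra E u"
  shows "gf1 E (Var \<iota>) oo (fps_const 2 * fps_X)
    = (gf1 E (Var \<eta> - Var u) oo (fps_const (1/2) * fps_X)) * gf1 E (Var \<iota>)"
    (is "?B2 = ?H2 * ?B")
proof -
  define e where "e = (fps_exp 1 :: real fps)"
  have e2: "fps_exp 2 = e * e"
    unfolding e_def by (simp flip: fps_exp_add_mult)
  have "(?B * (fps_exp 1 - 1)) oo (fps_const 2 * fps_X) = fps_X oo (fps_const 2 * fps_X)"
    by (simp add: gf1_bernoulli[OF assms(1)])
  then have "?B2 * ((fps_exp 1 oo (fps_const 2 * fps_X)) - 1) = fps_const 2 * fps_X"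
    by (simp add: fps_compose_mult_distrib fps_compose_sub_distrib del: fps_exp_compose_linear)
  then have B2: "?B2 * (e * e - 1) = 2 * fps_X"
    unfolding fps_exp_compose_linear by (simp add: e2 numeral_fps_const)
  have "(gf1 E (Var \<eta> - Var u) * (fps_exp 2 + 1)) oo (fps_const (1/2) * fps_X)
      = fps_const 2 oo (fps_const (1/2) * fps_X)"
    by (simp add: gf1_euler_diff_unity[OF assms(2,3)] numeral_fps_const)
  then have H2: "?H2 * (e + 1) = 2"
    by (simp add: fps_compose_mult_distrib fps_compose_add_distrib e_def numeral_fps_const)
  have B: "?B * (e - 1) = fps_X"
    using gf1_bernoulli[OF assms(1)] by (simp add: e_def)
  have "?B2 * (e * e - 1) = (?H2 * (e + 1)) * (?B * (e - 1))"
    unfolding B2 H2 B ..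
  also have "\<dots> = (?H2 * ?B) * (e * e - 1)" by (simp add: algebra_simps)
  finally have "?B2 * (e * e - 1) = (?H2 * ?B) * (e * e - 1)" .
  \<comment> \<open>This factor is no unit; being nonzero, it can still be cancelled in the integral
    domain of power series.\<close>
  moreover have "e * e - 1 \<noteq> 0"
  proof
    assume "e * e - 1 = 0"
    then have "(2 * fps_X :: real fps) = 0" using B2 by simp
    then show False by simp
  qed
  ultimately show ?thesis by simp
qed

text \<open>Raise the duplication formula to the power \<open>t\<close>, compare coefficients at
  \<open>|s|\<close>, and read \<open>sum_choose_convolution\<close> from right to left.\<close>

lemma bernoulli_moment_duplication:
  fixes t\<iota> t\<eta>u :: "'d::finite \<Rightarrow> 'u umbral"
  assumes "bernoulli_umbra E \<iota>" and "euler_umbra E \<eta>" and "unity_umbra E u"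
    and t\<iota>: "is_dot E t (\<lambda>_. Var \<iota>) t\<iota>"
    and t\<eta>u: "is_dot E t (\<lambda>_. Var \<eta> - Var u) t\<eta>u"
  shows "2 ^ (\<Sum>i\<in>UNIV. s i) * E (\<Prod>i\<in>UNIV. t\<iota> i ^ s i)
    = (\<Sum>a | a \<le> s. (\<Prod>i\<in>UNIV. real (s i choose a i))
        * (E (\<Prod>i\<in>UNIV. (Const (1/2) * t\<eta>u i) ^ a i) * E (\<Prod>i\<in>UNIV. t\<iota> i ^ (s i - a i))))"
proof -
  define B where "B = gf1 E (Var \<iota>)"
  define H where "H = gf1 E (Var \<eta> - Var u)"
  have [simp]: "B $ 0 = 1" "H $ 0 = 1" by (simp_all add: B_def H_def gf1_nth_0)
  have dup: "B oo (fps_const 2 * fps_X) = (H oo (fps_const (1/2) * fps_X)) * B"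
    unfolding B_def H_def using assms(1-3) by (rule gf1_bernoulli_duplication)
  have "fps_rpow B t oo (fps_const 2 * fps_X)
      = (fps_rpow H t oo (fps_const (1/2) * fps_X)) * fps_rpow B t"
    by (simp add: fps_rpow_compose_linear dup fps_rpow_mult del: fps_nth_compose_linear)
  then have "2 ^ n * fps_rpow B t $ n
      = ((fps_rpow H t oo (fps_const (1/2) * fps_X)) * fps_rpow B t) $ n" for n
    by (metis fps_nth_compose_linear)
  then have "2 ^ (\<Sum>i\<in>UNIV. s i) * E (\<Prod>i\<in>UNIV. t\<iota> i ^ s i)
      = ((fps_rpow H t oo (fps_const (1/2) * fps_X)) * fps_rpow B t) $ (\<Sum>i\<in>UNIV. s i)
          * fact (\<Sum>i\<in>UNIV. s i)"
    by (simp add: moment_dot_diagonal[OF t\<iota>] B_def)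
  also have "\<dots> = (\<Sum>a | a \<le> s. (\<Prod>i\<in>UNIV. real (s i choose a i))
        * (E (\<Prod>i\<in>UNIV. (Const (1/2) * t\<eta>u i) ^ a i) * E (\<Prod>i\<in>UNIV. t\<iota> i ^ (s i - a i))))"
    \<comment> \<open>The factor \<open>(1/2)^|a|\<close> from \<open>E_scale_prod\<close> matches
      the rescaling of \<open>H^t\<close> to argument \<open>z/2\<close>.\<close>
    unfolding sum_choose_convolution[symmetric] E_scale_prod
      moment_dot_diagonal[OF t\<iota>] moment_dot_diagonal[OF t\<eta>u]
    by (simp add: B_def H_def mult.assoc)
  finally show ?thesis .
qed

end

theorem theorem3p10:
  fixes E :: "'u umbral \<Rightarrow> real"
    and \<iota> \<eta> u :: 'u
    and t :: real
    and t\<iota> t\<eta>u :: "'d::finite \<Rightarrow> 'u umbral"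
    and v :: "'d \<Rightarrow> nat"
  assumes "umbral_calculus E"
    and "bernoulli_umbra E \<iota>"
    and "euler_umbra E \<eta>"
    and "unity_umbra E u"
    and "is_dot E t (\<lambda>_. Var \<iota>) t\<iota>"
    and "is_dot E t (\<lambda>_. Var \<eta> - Var u) t\<eta>u"
  shows "2 ^ (\<Sum>i\<in>UNIV. v i) * subst Const (\<lambda>i. Const (1/2) * Var i) (bernoulli_mpoly E t\<iota> v)
       = eval_x E (subst (\<lambda>c. Const (Const c)) (x_plus t\<iota>) (euler_mpoly E t\<eta>u v))"
proof -
  interpret umbral_calculus E by fact
  define C where "C x w = (\<Prod>i\<in>UNIV. real (x i choose w i))" for x w :: "'d \<Rightarrow> nat"
  define b where "b w = E (\<Prod>i\<in>UNIV. t\<iota> i ^ w i)" for w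
  define e where "e w = E (\<Prod>i\<in>UNIV. (Const (1/2) * t\<eta>u i) ^ w i)" for w
  define X where "X w = (\<Prod>i\<in>UNIV. Var i ^ w i :: ('d, real) mpol)" for w :: "'d \<Rightarrow> nat"
  have B: "bernoulli_mpoly E t\<iota> x = (\<Sum>w | w \<le> x. Const (C x w * b w) * X (\<lambda>i. x i - w i))" for x
    by (simp add: bernoulli_mpoly_def eval_x_prod_x_plus C_def b_def X_def)
  have two: "(2 :: ('d, real) mpol) = Const 2"
    using Const_of_nat[of 2, where 'c = real and 'i = 'd] by simp
  have "2 ^ (\<Sum>i\<in>UNIV. v i) * subst Const (\<lambda>i. Const (1/2) * Var i) (bernoulli_mpoly E t\<iota> v)
      = (\<Sum>s | s \<le> v. 2 ^ (\<Sum>i\<in>UNIV. v i) * (Const (C v s * b s)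
          * (\<Prod>i\<in>UNIV. (Const (1/2) * Var i) ^ (v i - s i))))"
    unfolding B X_def by (simp add: subst_sum subst_monomial Const_add sum_distrib_left)
  also have "\<dots> = (\<Sum>s | s \<le> v. Const (C v s * (2 ^ (\<Sum>i\<in>UNIV. s i) * b s)) * X (\<lambda>i. v i - s i))"
  proof (intro sum.cong refl)
    fix s assume "s \<in> {s. s \<le> v}"
    then have "s \<le> v" by simp
    then have le: "(\<Sum>i\<in>UNIV. s i) \<le> (\<Sum>i\<in>UNIV. v i)"
      by (intro sum_mono) (simp add: le_funD)
    define n where "n = (\<Sum>i\<in>UNIV. v i - s i)"
    \<comment> \<open>Halving the variables in a monomial of degree \<open>|v| - |s|\<close> leaves
      \<open>2^|s|\<close> of the prefactor \<open>2^|v|\<close>.\<close>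
    have pow: "(2::real) ^ (\<Sum>i\<in>UNIV. v i) * (1/2) ^ n = 2 ^ (\<Sum>i\<in>UNIV. s i)"
      using le unfolding n_def sum_fun_diff[OF \<open>s \<le> v\<close>] by (simp add: power_diff power_one_over)
    have "(\<Prod>i\<in>UNIV. (Const (1/2) * Var i) ^ (v i - s i)) = Const ((1/2) ^ n) * X (\<lambda>i. v i - s i)"
      unfolding n_def X_def power_mult_distrib prod.distrib power_sum Const_power Const_prod ..
    then have "2 ^ (\<Sum>i\<in>UNIV. v i) * (Const (C v s * b s)
          * (\<Prod>i\<in>UNIV. (Const (1/2) * Var i) ^ (v i - s i)))
        = Const (C v s * ((2 ^ (\<Sum>i\<in>UNIV. v i) * (1/2) ^ n) * b s)) * X (\<lambda>i. v i - s i)"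
      unfolding two Const_mult Const_power by (simp only: mult_ac)
    then show "2 ^ (\<Sum>i\<in>UNIV. v i) * (Const (C v s * b s)
          * (\<Prod>i\<in>UNIV. (Const (1/2) * Var i) ^ (v i - s i)))
        = Const (C v s * (2 ^ (\<Sum>i\<in>UNIV. s i) * b s)) * X (\<lambda>i. v i - s i)"
      unfolding pow .
  qed
  also have "\<dots> = (\<Sum>s | s \<le> v. \<Sum>a | a \<le> s.
      Const (C v s * (C s a * (e a * b (\<lambda>i. s i - a i)))) * X (\<lambda>i. v i - s i))"
    using bernoulli_moment_duplication[OF assms(2-6)]
    by (simp add: C_def b_def e_def sum_distrib_left sum_distrib_right Const_sum)
  \<comment> \<open>Summing over \<open>s = a + r\<close> with \<open>a\<close> outermost separates
    the Euler moments \<open>e a\<close> from the Bernoulli moments \<open>b r\<close>.\<close>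
  also have "\<dots> = (\<Sum>a | a \<le> v. \<Sum>r | r \<le> (\<lambda>i. v i - a i).
      Const (C v (\<lambda>i. a i + r i) * (C (\<lambda>i. a i + r i) a * (e a * b r))) * X (\<lambda>i. v i - a i - r i))"
    by (subst sum_fun_le_swap) simp
  also have "\<dots> = (\<Sum>a | a \<le> v. \<Sum>r | r \<le> (\<lambda>i. v i - a i).
      Const (C v a * e a) * (Const (C (\<lambda>i. v i - a i) r * b r) * X (\<lambda>i. v i - a i - r i)))"
  proof (intro sum.cong refl)
    fix a r assume "a \<in> {a. a \<le> v}" "r \<in> {r. r \<le> (\<lambda>i. v i - a i)}"
    then have "a \<le> (\<lambda>i. a i + r i)" "(\<lambda>i. a i + r i) \<le> v"
      by (auto simp: le_fun_def le_diff_conv2 add.commute)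
    then have eq: "C v (\<lambda>i. a i + r i) * C (\<lambda>i. a i + r i) a = C v a * C (\<lambda>i. v i - a i) r"
      unfolding C_def by (subst prod_choose_mult) simp_all
    have "C v (\<lambda>i. a i + r i) * (C (\<lambda>i. a i + r i) a * (e a * b r))
        = (C v a * e a) * (C (\<lambda>i. v i - a i) r * b r)"
      unfolding mult.assoc[symmetric] eq by (simp only: mult_ac)
    then show "Const (C v (\<lambda>i. a i + r i) * (C (\<lambda>i. a i + r i) a * (e a * b r)))
          * X (\<lambda>i. v i - a i - r i)
        = Const (C v a * e a) * (Const (C (\<lambda>i. v i - a i) r * b r) * X (\<lambda>i. v i - a i - r i))"
      by (simp only: Const_mult mult.assoc)
  qed
  \<comment> \<open>The inner sum over \<open>r\<close> is the expansion \<open>B\<close> of the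
    Bernoulli polynomial of index \<open>v - a\<close>.\<close>
  also have "\<dots> = (\<Sum>a | a \<le> v. Const (C v a * e a) * bernoulli_mpoly E t\<iota> (\<lambda>i. v i - a i))"
    by (simp add: B sum_distrib_left)
  \<comment> \<open>The Euler polynomial is already evaluated, so each \<open>e a\<close> is a
    scalar and no joint moments of \<open>t\<iota>\<close> and \<open>t\<eta>u\<close> occur.
    Replacing \<open>x\<close> by \<open>x + t\<iota>\<close> in its monomial of exponent
    \<open>v - a\<close> and evaluating gives a Bernoulli polynomial by definition.\<close>
  also have "\<dots> = eval_x E (subst (\<lambda>c. Const (Const c)) (x_plus t\<iota>) (euler_mpoly E t\<eta>u v))"
    unfolding euler_mpoly_def eval_x_prod_x_plus
    by (simp add: subst_sum subst_monomial Const_add eval_x_sum eval_x_scale C_def e_def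
        bernoulli_mpoly_def)
  finally show ?thesis .
qed

end
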